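(* Let $I\in\mathbb{S}$ be fixed. Let $f\in L^2(\mathbb{R},\mathbb{H})$ and $2\le p<\infty$. Then $$\int_{\mathbb{R}^2}|\mathcal{V}_\varphi f(x,\omega)|^p\,dx\,d\omega\le\frac{2^{p+1}}{p}\,\|f\|^p_{L^2(\mathbb{R},\mathbb{H})}.$$
   Context: $\mathbb{H}$ is the algebra of real quaternions, $\mathbb{S}=\{q\in\mathbb{H}:q^2=-1\}$. $L^2(\mathbb{R},\mathbb{H})$ is the space of square integrable $\mathbb{H}$-valued functions with norm $\|f\|^2=\int_{\mathbb{R}}|f(t)|^2dt$. The quaternionic Segal-Bargmann transform with parameter $\nu=2\pi$ is $\mathcal{B}^S_{\mathbb{H}}(f)(q)=\int_{\mathbb{R}}2^{3/4}e^{-\pi(q^2+t^2)+2\pi\sqrt2\,qt}f(t)\,dt$, $q\in\mathbb{H}$. Let $\varphi(t)=2^{1/4}e^{-\pi t^2}$. For $I\in\mathbb{S}$ fixed, the 1D quaternion short-time Fourier transform (QSTFT) of $f\in L^2(\mathbb{R},\mathbb{H})$ with window $\varphi$ is $$\mathcal{V}_\varphi f(x,\omega)=e^{-I\pi x\omega}\,\mathcal{B}^S_{\mathbb{H}}(f)\!\left(\frac{\bar q}{\sqrt2}\right)e^{-\frac{\pi|q|^2}{2}},\qquad q=x+I\omega,\ (x,\omega)\in\mathbb{R}^2.$$ *)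

theory Defs
  imports "HOL-Analysis.Analysis"
begin

section \<open>The real quaternions\<close>

datatype quat = Quat (qre: real) (qim1: real) (qim2: real) (qim3: real)

lemma quat_eqI:
  "qre x = qre y \<Longrightarrow> qim1 x = qim1 y \<Longrightarrow> qim2 x = qim2 y \<Longrightarrow> qim3 x = qim3 y \<Longrightarrow> x = y"
  by (cases x; cases y) simp

lemma quat_eq_iff:
  "x = y \<longleftrightarrow> qre x = qre y \<and> qim1 x = qim1 y \<and> qim2 x = qim2 y \<and> qim3 x = qim3 y"
  by (auto intro: quat_eqI)

instantiation quat :: real_algebra_1
begin

definition "0 = Quat 0 0 0 0"
definition "1 = Quat 1 0 0 0"
definition "x + y = Quat (qre x + qre y) (qim1 x + qim1 y) (qim2 x + qim2 y) (qim3 x + qim3 y)"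
definition "- x = Quat (- qre x) (- qim1 x) (- qim2 x) (- qim3 x)"
definition "x - y = Quat (qre x - qre y) (qim1 x - qim1 y) (qim2 x - qim2 y) (qim3 x - qim3 y)"
definition "r *\<^sub>R x = Quat (r * qre x) (r * qim1 x) (r * qim2 x) (r * qim3 x)"

definition "x * y = Quat
  (qre x * qre y - qim1 x * qim1 y - qim2 x * qim2 y - qim3 x * qim3 y)
  (qre x * qim1 y + qim1 x * qre y + qim2 x * qim3 y - qim3 x * qim2 y)
  (qre x * qim2 y - qim1 x * qim3 y + qim2 x * qre y + qim3 x * qim1 y)
  (qre x * qim3 y + qim1 x * qim2 y - qim2 x * qim1 y + qim3 x * qre y)"

instance
  by standard
    (simp_all add: zero_quat_def one_quat_def plus_quat_def uminus_quat_def minus_quat_def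
      scaleR_quat_def times_quat_def algebra_simps)

end

lemma quat_sel [simp]:
  "qre 0 = 0" "qim1 0 = 0" "qim2 0 = 0" "qim3 0 = 0"
  "qre 1 = 1" "qim1 1 = 0" "qim2 1 = 0" "qim3 1 = 0"
  "qre (x + y) = qre x + qre y" "qim1 (x + y) = qim1 x + qim1 y"
  "qim2 (x + y) = qim2 x + qim2 y" "qim3 (x + y) = qim3 x + qim3 y"
  "qre (- x) = - qre x" "qim1 (- x) = - qim1 x"
  "qim2 (- x) = - qim2 x" "qim3 (- x) = - qim3 x"
  "qre (x - y) = qre x - qre y" "qim1 (x - y) = qim1 x - qim1 y"
  "qim2 (x - y) = qim2 x - qim2 y" "qim3 (x - y) = qim3 x - qim3 y"
  "qre (r *\<^sub>R x) = r * qre x" "qim1 (r *\<^sub>R x) = r * qim1 x"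
  "qim2 (r *\<^sub>R x) = r * qim2 x" "qim3 (r *\<^sub>R x) = r * qim3 x"
  by (simp_all add: zero_quat_def one_quat_def plus_quat_def uminus_quat_def minus_quat_def
      scaleR_quat_def)

lemma quat_times_sel:
  "qre (x * y) = qre x * qre y - qim1 x * qim1 y - qim2 x * qim2 y - qim3 x * qim3 y"
  "qim1 (x * y) = qre x * qim1 y + qim1 x * qre y + qim2 x * qim3 y - qim3 x * qim2 y"
  "qim2 (x * y) = qre x * qim2 y - qim1 x * qim3 y + qim2 x * qre y + qim3 x * qim1 y"
  "qim3 (x * y) = qre x * qim3 y + qim1 x * qim2 y - qim2 x * qim1 y + qim3 x * qre y"
  by (simp_all add: times_quat_def)

definition qcnj :: "quat \<Rightarrow> quat" where
  "qcnj x = Quat (qre x) (- qim1 x) (- qim2 x) (- qim3 x)"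

lemma quat_sum_squares_eq_0_iff:
  "(qre x)\<^sup>2 + (qim1 x)\<^sup>2 + (qim2 x)\<^sup>2 + (qim3 x)\<^sup>2 = 0 \<longleftrightarrow> x = 0"
  by (auto simp: quat_eq_iff add_nonneg_eq_0_iff)

instantiation quat :: division_ring
begin

definition
  "inverse x = qcnj x /\<^sub>R ((qre x)\<^sup>2 + (qim1 x)\<^sup>2 + (qim2 x)\<^sup>2 + (qim3 x)\<^sup>2)"
definition "x div y = x * inverse y" for x y :: quat

instance
proof
  fix x :: quat
  let ?n = "(qre x)\<^sup>2 + (qim1 x)\<^sup>2 + (qim2 x)\<^sup>2 + (qim3 x)\<^sup>2"
  have c: "qcnj x * x = of_real ?n" "x * qcnj x = of_real ?n"
    by (simp_all add: quat_eq_iff quat_times_sel qcnj_def of_real_def power2_eq_square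
        algebra_simps)
  assume "x \<noteq> 0"
  then have "?n \<noteq> 0" using quat_sum_squares_eq_0_iff by blast
  then show "inverse x * x = 1" "x * inverse x = 1"
    unfolding inverse_quat_def by (simp_all add: c of_real_def)
qed (simp_all add: divide_quat_def inverse_quat_def quat_eq_iff qcnj_def)

end

instantiation quat :: real_inner
begin

definition "x \<bullet> y = qre x * qre y + qim1 x * qim1 y + qim2 x * qim2 y + qim3 x * qim3 y"
definition "norm x = sqrt (x \<bullet> x)" for x :: quat
definition "sgn x = x /\<^sub>R norm x" for x :: quat
definition "dist x y = norm (x - y)" for x y :: quat
definition
  "uniformity = (INF e\<in>{0<..}. principal {(x :: quat, y). dist x y < e})"
definition
  "open U \<longleftrightarrow> (\<forall>x\<in>U. eventually (\<lambda>(x', y). x' = x \<longrightarrow> y \<in> U) uniformity)" for U :: "quat set"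

instance
proof
  fix x y z :: quat and r :: real
  show "(x \<bullet> x = 0) = (x = 0)"
    using quat_sum_squares_eq_0_iff[of x] by (simp add: inner_quat_def power2_eq_square)
qed (simp_all add: inner_quat_def norm_quat_def sgn_quat_def dist_quat_def uniformity_quat_def
      open_quat_def algebra_simps)

end

lemma norm_quat_eq:
  "norm x = sqrt ((qre x)\<^sup>2 + (qim1 x)\<^sup>2 + (qim2 x)\<^sup>2 + (qim3 x)\<^sup>2)" for x :: quat
  by (simp add: norm_quat_def inner_quat_def power2_eq_square)

instance quat :: real_normed_div_algebra
proof
  fix x y :: quat
  show "norm (x * y) = norm x * norm y"
    unfolding norm_quat_eq real_sqrt_mult[symmetric]
    by (simp add: quat_times_sel power2_eq_square algebra_simps)
qed

instantiation quat :: euclidean_space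
begin

definition "Basis = {Quat 1 0 0 0, Quat 0 1 0 0, Quat 0 0 1 0, Quat 0 0 0 1}"

instance
proof
  fix x :: quat
  show "(\<forall>u\<in>Basis. x \<bullet> u = 0) = (x = 0)"
    by (simp add: Basis_quat_def inner_quat_def quat_eq_iff[of x 0])
qed (auto simp: Basis_quat_def inner_quat_def)

end

section \<open>The transforms\<close>

definition imaginary_units :: "quat set" where
  "imaginary_units = {q. q\<^sup>2 = - 1}"

definition square_integrable :: "(real \<Rightarrow> quat) \<Rightarrow> bool" where
  "square_integrable f \<longleftrightarrow>
     f \<in> borel_measurable lebesgue \<and> integrable lebesgue (\<lambda>t. (norm (f t))\<^sup>2)"

definition L2_norm :: "(real \<Rightarrow> quat) \<Rightarrow> real" where
  "L2_norm f = sqrt (LINT t|lebesgue. (norm (f t))\<^sup>2)"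

text \<open>The parameter of the transform is \<open>\<nu> = 2 * pi\<close>.  As \<open>quat\<close> is not commutative, the order of
  the factors matters: the kernel multiplies the values of \<open>f\<close> from the left.\<close>

definition segal_bargmann :: "(real \<Rightarrow> quat) \<Rightarrow> quat \<Rightarrow> quat" where
  "segal_bargmann f q =
     (LINT t|lebesgue.
        (2 powr (3/4)) *\<^sub>R
          exp (- (pi *\<^sub>R (q\<^sup>2 + of_real (t\<^sup>2))) + (2 * pi * sqrt 2 * t) *\<^sub>R q) * f t)"

text \<open>The short-time Fourier transform for the Gaussian window
  \<open>\<phi> t = 2 powr (1/4) * exp (- pi * t\<^sup>2)\<close>, which is fixed and enters only through this formula.\<close>

definition qstft :: "quat \<Rightarrow> (real \<Rightarrow> quat) \<Rightarrow> real \<Rightarrow> real \<Rightarrow> quat" where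
  "qstft I f x \<omega> =
     (let q = of_real x + I * of_real \<omega>
      in exp (- (pi * x * \<omega>) *\<^sub>R I) * segal_bargmann f (qcnj q /\<^sub>R sqrt 2)
           * of_real (exp (- (pi * (norm q)\<^sup>2 / 2))))"

end

theory Submission
  imports Defs "HOL-Probability.Probability"
begin

text \<open>Completing the square shows that the short-time Fourier transform at \<open>(x, \<omega>)\<close> equals
  \<open>2 powr (3/4)\<close> times the quaternionic Fourier integral at \<open>\<omega>\<close> of \<open>t \<mapsto> exp (- pi * (x - t)\<^sup>2) * f t\<close>.
  Cauchy--Schwarz bounds it uniformly by \<open>sqrt 2 * L2_norm f\<close>.  Plancherel's inequality in \<open>\<omega>\<close>
  followed by Tonelli in \<open>x\<close> bounds its square integral by \<open>2 * (L2_norm f)\<^sup>2\<close>.  Interpolating between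
  the two bounds gives the constant \<open>2 powr (p / 2)\<close>, which is at most \<open>2 powr (p + 1) / p\<close>.\<close>

section \<open>Imaginary units and their exponentials\<close>

lemma imaginary_unit:
  assumes "I \<in> imaginary_units"
  shows imaginary_unit_square: "I * I = - 1"
    and imaginary_unit_norm: "norm I = 1"
    and imaginary_unit_re: "qre I = 0"
proof -
  show *: "I * I = - 1"
    using assms by (simp add: imaginary_units_def power2_eq_square)
  have "norm I * norm I = 1"
    using arg_cong[OF *, of norm] by (simp add: norm_mult)
  then show n: "norm I = 1"
    by (metis abs_norm_cancel abs_square_eq_1 power2_eq_square)
  \<comment> \<open>The real part of \<open>I * I = - 1\<close> and the equation
    \<open>norm I = 1\<close> differ only in the sign of the imaginary squares; adding them leaves
    \<open>2 * (qre I)\<^sup>2 = 0\<close>.\<close>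
  have "qre I * qre I - qim1 I * qim1 I - qim2 I * qim2 I - qim3 I * qim3 I = - 1"
    using arg_cong[OF *, of qre] by (simp add: quat_times_sel)
  moreover have "qre I * qre I + qim1 I * qim1 I + qim2 I * qim2 I + qim3 I * qim3 I = 1"
    using n by (simp add: norm_quat_eq power2_eq_square)
  ultimately show "qre I = 0"
    by (smt (verit) zero_less_mult_iff mult_eq_0_iff not_real_square_gt_zero)
qed

text \<open>Euler's formula by uniqueness for a linear differential equation: multiplying the
  right-hand side by \<open>exp (- t I)\<close> gives a function with derivative zero. The two terms
  of the product rule cancel without commutativity, because both place \<open>I\<close> between the
  same two factors.\<close>

lemma exp_imaginary_unit:
  assumes "I \<in> imaginary_units"
  shows "exp (\<theta> *\<^sub>R I) = of_real (cos \<theta>) + sin \<theta> *\<^sub>R I"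
proof -
  note I = imaginary_unit_square[OF assms]
  define h where "h t = exp ((- t) *\<^sub>R I) * (of_real (cos t) + sin t *\<^sub>R I)" for t
  have e: "((\<lambda>t. exp ((- t) *\<^sub>R I)) has_vector_derivative - (exp ((- t) *\<^sub>R I) * I)) (at t)" for t
    using exp_scaleR_has_vector_derivative_right[of "- I" t] by simp
  have c: "((\<lambda>t. of_real (cos t) + sin t *\<^sub>R I) has_vector_derivative
      I * (of_real (cos t) + sin t *\<^sub>R I)) (at t)" for t
    by (auto intro!: derivative_eq_intros simp: of_real_def I algebra_simps
        has_real_derivative_iff_has_vector_derivative[symmetric])
  have "(h has_vector_derivative 0) (at t)" for t
    unfolding h_def
    by (rule has_vector_derivative_eq_rhs[OF has_vector_derivative_mult[OF e c]])
       (simp add: mult.assoc)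
  then obtain k where k: "\<And>t. h t = k"
    using has_vector_derivative_zero_constant[of UNIV h] by auto
  have "h \<theta> = 1" using k[of \<theta>] k[of 0] by (simp add: h_def)
  moreover have "exp (\<theta> *\<^sub>R I) * exp ((- \<theta>) *\<^sub>R I) = 1"
    using exp_minus_inverse[of "\<theta> *\<^sub>R I"] by simp
  ultimately show ?thesis
    unfolding h_def by (metis mult.assoc mult_1 mult.right_neutral)
qed

text \<open>The adjoint of left multiplication by a quaternion is left multiplication by its
  conjugate, and the conjugate of \<open>I\<close> is \<open>- I\<close> because its real part
  vanishes.\<close>

lemma imaginary_unit_inner:
  assumes "I \<in> imaginary_units"
  shows "(I * u) \<bullet> v = - (u \<bullet> (I * v))"
  using imaginary_unit_re[OF assms] by (simp add: inner_quat_def quat_times_sel algebra_simps)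

text \<open>Skew-adjointness of \<open>I\<close> lets the four terms of the expansion combine
  through the addition formulas. The result separates an even and an odd function of the phase
  difference, ready for integration against an even weight.\<close>

lemma inner_exp_imaginary_unit:
  assumes "I \<in> imaginary_units"
  shows "(exp (\<alpha> *\<^sub>R I) * u) \<bullet> (exp (\<beta> *\<^sub>R I) * v) =
    cos (\<alpha> - \<beta>) * (u \<bullet> v) + sin (\<alpha> - \<beta>) * ((I * u) \<bullet> v)"
proof -
  have "I * (I * v) = - v"
    using imaginary_unit_square[OF assms] by (simp add: mult.assoc[symmetric])
  then show ?thesis
    unfolding exp_imaginary_unit[OF assms]
    by (simp add: of_real_def inner_add_left inner_add_right
        imaginary_unit_inner[OF assms] cos_diff sin_diff algebra_simps)
qed

lemma norm_exp_imaginary_unit: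
  assumes "I \<in> imaginary_units"
  shows "norm (exp (\<theta> *\<^sub>R I)) = 1"
  using inner_exp_imaginary_unit[OF assms, of \<theta> 1 \<theta> 1]
  by (simp add: norm_eq_sqrt_inner inner_quat_def)

section \<open>Gaussian integrals on the line\<close>

lemma has_bochner_integral_gaussian:
  assumes "c > 0"
  shows "has_bochner_integral lborel (\<lambda>t::real. exp (- (pi * c * (m - t)\<^sup>2))) (1 / sqrt c)"
proof -
  \<comment> \<open>With variance \<open>1 / (2 * pi * c)\<close> the exponent of the normal density
    is the required one and its normalising factor is \<open>sqrt c\<close>.\<close>
  define s where "s = 1 / sqrt (2 * pi * c)"
  have s: "s > 0" "s\<^sup>2 = 1 / (2 * pi * c)"
    using assms by (simp_all add: s_def power_divide)
  have "has_bochner_integral lborel (\<lambda>t. (1 / sqrt c) * normal_density m s t) ((1 / sqrt c) * 1)"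
    by (intro has_bochner_integral_mult_right)
       (use s in \<open>simp add: has_bochner_integral_iff\<close>)
  moreover have "(1 / sqrt c) * normal_density m s t = exp (- (pi * c * (m - t)\<^sup>2))" for t
  proof -
    have "2 * pi * s\<^sup>2 = 1 / c" "2 * s\<^sup>2 = 1 / (pi * c)"
      using assms by (simp_all add: s(2))
    then show ?thesis
      using assms by (simp add: normal_density_def power2_commute real_sqrt_divide mult.commute)
  qed
  ultimately show ?thesis by simp
qed

lemma has_bochner_integral_gaussian_square:
  "has_bochner_integral lborel (\<lambda>t::real. (exp (- (pi * (m - t)\<^sup>2)))\<^sup>2) (1 / sqrt 2)"
  using has_bochner_integral_gaussian[of 2 m] by (simp add: ac_simps flip: exp_double)

text \<open>These are the real and imaginary parts of the characteristic function of the standard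
  normal distribution at \<open>c * b\<close>, rescaled.\<close>

lemma has_bochner_integral_gaussian_trig:
  assumes "c > 0"
  shows "has_bochner_integral lborel (\<lambda>t. exp (- ((t / c)\<^sup>2 / 2)) * cos (b * t))
           (c * sqrt (2 * pi) * exp (- ((c * b)\<^sup>2 / 2)))" (is ?C)
    and "has_bochner_integral lborel (\<lambda>t. exp (- ((t / c)\<^sup>2 / 2)) * sin (b * t)) 0" (is ?S)
proof -
  interpret real_distribution std_normal_distribution
    by (rule real_dist_normal_dist)
  have int: "integrable std_normal_distribution (\<lambda>x. iexp (c * b * x))"
    by (rule integrable_const_bound[where B=1]) auto
  have "has_bochner_integral std_normal_distribution (\<lambda>x. iexp (c * b * x))
      (complex_of_real (exp (- ((c * b)\<^sup>2 / 2))))"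
    using fun_cong[OF char_std_normal_distribution, of "c * b"] int
    by (simp add: has_bochner_integral_iff char_def)
  note R = has_bochner_integral_Re[OF this] has_bochner_integral_Im[OF this]
  have C: "has_bochner_integral lborel (\<lambda>x. std_normal_density x * cos (c * b * x)) (exp (- ((c * b)\<^sup>2 / 2)))"
    using R(1) by (simp add: has_bochner_integral_iff integrable_density integral_density Re_exp)
  have S: "has_bochner_integral lborel (\<lambda>x. std_normal_density x * sin (c * b * x)) 0"
    using R(2) by (simp add: has_bochner_integral_iff integrable_density integral_density Im_exp)
  \<comment> \<open>The substitution of \<open>x / c\<close> for \<open>x\<close> turns frequency
    \<open>c * b\<close> into \<open>b\<close> and contributes the factor \<open>c\<close>;
    \<open>sqrt (2 * pi)\<close> removes the normalisation of the density.\<close>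
  have C': "has_bochner_integral lborel (\<lambda>x. sqrt (2 * pi) * (std_normal_density (x / c) * cos (c * b * (x / c))))
     (sqrt (2 * pi) * (c * exp (- ((c * b)\<^sup>2 / 2))))"
    using C assms
    by (intro has_bochner_integral_mult_right, subst (asm) lborel_has_bochner_integral_real_affine_iff[of "1 / c" _ _ 0])
       (auto simp: mult.commute)
  have S': "has_bochner_integral lborel (\<lambda>x. sqrt (2 * pi) * (std_normal_density (x / c) * sin (c * b * (x / c))))
     (sqrt (2 * pi) * 0)"
    using S assms
    by (intro has_bochner_integral_mult_right, subst (asm) lborel_has_bochner_integral_real_affine_iff[of "1 / c" _ _ 0])
       (auto simp: mult.commute)
  show ?C using C' assms by (simp add: std_normal_density_def ac_simps)
  show ?S using S' assms by (simp add: std_normal_density_def ac_simps)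
qed

section \<open>Double integrals, convolutions and Bessel's inequality for the Fourier
  integral\<close>

lemma integrable_lborel_mult_prod:
  fixes u :: "'a::euclidean_space \<Rightarrow> real" and v :: "'b::euclidean_space \<Rightarrow> real"
  assumes u: "integrable lborel u" and v: "integrable lborel v"
  shows "integrable lborel (\<lambda>(x, y). u x * v y)"
proof -
  note [measurable] = borel_measurable_integrable[OF u] borel_measurable_integrable[OF v]
  have "integrable (lborel \<Otimes>\<^sub>M lborel) (\<lambda>(x, y). u x * v y)"
    by (rule lborel_pair.Fubini_integrable) (use u v in \<open>auto simp: abs_mult\<close>)
  then show ?thesis by (simp add: lborel_prod)
qed

text \<open>Fubini with \<open>k\<close> integrated out first, its integral being invariant under
  translation and reflection. The two versions serve the two squares in the bound for
  \<open>g t \<bullet> g s\<close>; the second also integrates the windowed signal over all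
  positions of the window.\<close>

lemma has_bochner_integral_convolution:
  fixes h k :: "real \<Rightarrow> real"
  assumes h: "integrable lborel h" and k: "integrable lborel k"
  shows "has_bochner_integral lborel (\<lambda>(t, s). h t * k (t - s)) ((LBINT t. h t) * (LBINT t. k t))"
    and "has_bochner_integral lborel (\<lambda>(t, s). h s * k (t - s)) ((LBINT t. h t) * (LBINT t. k t))"
proof -
  note [measurable] = borel_measurable_integrable[OF h] borel_measurable_integrable[OF k]
  have shift: "integrable lborel (\<lambda>s. k (t - s))" "(LBINT s. k (t - s)) = (LBINT t. k t)"
     "(LBINT s. \<bar>k (t - s)\<bar>) = (LBINT t. \<bar>k t\<bar>)" for t
    using lborel_integrable_real_affine[OF k, of "-1" t] lborel_integral_real_affine[of "-1" k t]
       lborel_integral_real_affine[of "-1" "\<lambda>s. \<bar>k s\<bar>" t]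
    by simp_all
  have shift': "integrable lborel (\<lambda>t. k (t - s))" "(LBINT t. k (t - s)) = (LBINT t. k t)"
     "(LBINT t. \<bar>k (t - s)\<bar>) = (LBINT t. \<bar>k t\<bar>)" for s
    using lborel_integrable_real_affine[OF k, of 1 "- s"] lborel_integral_real_affine[of 1 k "- s"]
       lborel_integral_real_affine[of 1 "\<lambda>s. \<bar>k s\<bar>" "- s"]
    by simp_all
  have 1: "integrable (lborel \<Otimes>\<^sub>M lborel) (\<lambda>(t, s). h t * k (t - s))"
    by (rule lborel_pair.Fubini_integrable) (use h in \<open>auto simp: abs_mult shift\<close>)
  have 2: "integrable (lborel \<Otimes>\<^sub>M lborel) (\<lambda>(s, t). h s * k (t - s))"
    by (rule lborel_pair.Fubini_integrable) (use h in \<open>auto simp: abs_mult shift'\<close>)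
  have 3: "integrable (lborel \<Otimes>\<^sub>M lborel) (\<lambda>(t, s). h s * k (t - s))"
    using lborel_pair.integrable_product_swap[OF 2] by (simp add: split_beta')
  show "has_bochner_integral lborel (\<lambda>(t, s). h t * k (t - s)) ((LBINT t. h t) * (LBINT t. k t))"
    using 1 lborel_pair.integral_fst'[OF 1]
    by (simp add: has_bochner_integral_iff lborel_prod shift)
  show "has_bochner_integral lborel (\<lambda>(t, s). h s * k (t - s)) ((LBINT t. h t) * (LBINT t. k t))"
    using 3 lborel_pair.integral_snd[OF 3]
    by (simp add: has_bochner_integral_iff lborel_prod shift')
qed

text \<open>With the Gaussian weight, Fubini turns the left-hand side into the double integral of
  \<open>(g t \<bullet> g s) * k (t - s)\<close> for a Gaussian \<open>k\<close> of integral 1, and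
  \<open>2 * (g t \<bullet> g s) \<le> (norm (g t))\<^sup>2 + (norm (g s))\<^sup>2\<close>.  The part of the integrand that involves \<open>I\<close>
  is odd in \<open>\<omega>\<close> and drops out.\<close>

lemma regularized_fourier_bessel:
  fixes g :: "real \<Rightarrow> quat"
  assumes I: "I \<in> imaginary_units"
    and g1: "integrable lborel g" and g2: "integrable lborel (\<lambda>t. (norm (g t))\<^sup>2)" and c: "c > 0"
  shows "(\<integral>\<^sup>+\<omega>. ennreal (exp (- ((\<omega> / c)\<^sup>2 / 2)) *
      (norm (LBINT t. exp ((- (2 * pi * \<omega> * t)) *\<^sub>R I) * g t))\<^sup>2) \<partial>lborel)
      \<le> ennreal (LBINT t. (norm (g t))\<^sup>2)"
proof -
  note [measurable] = borel_measurable_integrable[OF g1]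
  have [measurable]: "(\<lambda>x. exp (x *\<^sub>R I)) \<in> borel_measurable borel"
    unfolding exp_imaginary_unit[OF I] of_real_def by measurable
  define e where "e \<omega> t = exp ((- (2 * pi * \<omega> * t)) *\<^sub>R I)" for \<omega> t
  define w where "w \<omega> = exp (- ((\<omega> / c)\<^sup>2 / 2))" for \<omega> :: real
  define E where "E \<omega> = (LBINT t. e \<omega> t * g t)" for \<omega>
  define H where "H = (\<lambda>(\<omega>, t, s). w \<omega> * ((e \<omega> t * g t) \<bullet> (e \<omega> s * g s)))"
  define k where "k u = c * sqrt (2 * pi) * exp (- ((c * (2 * pi * u))\<^sup>2 / 2))" for u
  have e_norm: "norm (e \<omega> t * q) = norm q" for \<omega> t q
    by (simp only: e_def norm_mult norm_exp_imaginary_unit[OF I] mult_1)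
  have [measurable]: "(\<lambda>(\<omega>, t). e \<omega> t) \<in> borel_measurable (borel \<Otimes>\<^sub>M borel)"
    unfolding e_def by measurable
  have [measurable]: "w \<in> borel_measurable borel"
    unfolding w_def by measurable
  have eg: "integrable lborel (\<lambda>t. e \<omega> t * g t)" for \<omega>
    by (rule Bochner_Integration.integrable_bound[OF g1]) (auto simp: e_norm)
  have w_int: "integrable lborel w"
    using has_bochner_integral_gaussian_trig(1)[OF c, of 0]
    by (simp add: has_bochner_integral_iff w_def[abs_def])
  have gg: "integrable lborel (\<lambda>(t, s). norm (g t) * norm (g s))"
    using g1 by (intro integrable_lborel_mult_prod) auto
  \<comment> \<open>The exponentials have norm one, so Cauchy--Schwarz bounds the inner product by
    \<open>norm (g t) * norm (g s)\<close>. Integrability in \<omega> comes from the weight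
    \<open>w\<close> alone, which is why the regularization is introduced.\<close>
  have H_int: "integrable lborel H"
  proof (rule Bochner_Integration.integrable_bound[OF integrable_lborel_mult_prod[OF w_int gg]])
    have "H \<in> borel_measurable (borel \<Otimes>\<^sub>M (borel \<Otimes>\<^sub>M borel))"
      unfolding H_def by measurable
    then show "H \<in> borel_measurable lborel"
      by (simp add: borel_prod)
    show "AE x in lborel. norm (H x) \<le> norm (case x of (\<omega>, ts) \<Rightarrow> w \<omega> * (case ts of (t, s) \<Rightarrow> norm (g t) * norm (g s)))"
      using Cauchy_Schwarz_ineq2[of "e _ _ * g _" "e _ _ * g _"]
      by (auto simp: H_def w_def abs_mult e_norm intro!: mult_left_mono)
  qed
  then have H_int': "integrable (lborel \<Otimes>\<^sub>M lborel) H"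
    by (simp add: lborel_prod)
  \<comment> \<open>By bilinearity the integrals over \<open>t\<close> and \<open>s\<close> move
    into the two arguments of the inner product, giving
    \<open>E \<omega> \<bullet> E \<omega>\<close>.\<close>
  have H_fst: "(LBINT ts. H (\<omega>, ts)) = w \<omega> * (norm (E \<omega>))\<^sup>2" for \<omega>
  proof -
    have "integrable lborel (\<lambda>(t, s). (e \<omega> t * g t) \<bullet> (e \<omega> s * g s))"
    proof (rule Bochner_Integration.integrable_bound[OF gg])
      have "(\<lambda>(t, s). (e \<omega> t * g t) \<bullet> (e \<omega> s * g s)) \<in> borel_measurable (borel \<Otimes>\<^sub>M borel)"
        by measurable
      then show "(\<lambda>(t, s). (e \<omega> t * g t) \<bullet> (e \<omega> s * g s)) \<in> borel_measurable lborel"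
        by (simp add: borel_prod)
    qed (use Cauchy_Schwarz_ineq2[of "e _ _ * g _" "e _ _ * g _"] in \<open>auto simp: abs_mult e_norm\<close>)
    then have i: "integrable (lborel \<Otimes>\<^sub>M lborel) (\<lambda>(t, s). (e \<omega> t * g t) \<bullet> (e \<omega> s * g s))"
      by (simp add: lborel_prod)
    have "(LBINT ts. H (\<omega>, ts)) = w \<omega> * (LBINT ts. (case ts of (t, s) \<Rightarrow> (e \<omega> t * g t) \<bullet> (e \<omega> s * g s)))"
      by (simp add: H_def split_beta')
    also have "(LBINT ts. (case ts of (t, s) \<Rightarrow> (e \<omega> t * g t) \<bullet> (e \<omega> s * g s)))
        = (LBINT t. LBINT s. (e \<omega> t * g t) \<bullet> (e \<omega> s * g s))"
      using lborel_pair.integral_fst'[OF i] by (simp add: lborel_prod)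
    also have "\<dots> = E \<omega> \<bullet> E \<omega>"
      using eg[of \<omega>] by (simp add: E_def)
    finally show ?thesis by (simp add: power2_norm_eq_inner)
  qed
  have H_snd: "(LBINT \<omega>. H (\<omega>, ts)) = (case ts of (t, s) \<Rightarrow> (g t \<bullet> g s) * k (t - s))" for ts
  proof -
    obtain t s where ts: "ts = (t, s)" by force
    define b where "b = 2 * pi * (s - t)"
    note G = has_bochner_integral_gaussian_trig[OF c, of b, folded w_def]
    have "H (\<omega>, ts) = (w \<omega> * cos (b * \<omega>)) * (g t \<bullet> g s) + (w \<omega> * sin (b * \<omega>)) * ((I * g t) \<bullet> g s)" for \<omega>
    proof -
      have *: "- (2 * pi * \<omega> * t) - - (2 * pi * \<omega> * s) = b * \<omega>"
        by (simp add: b_def algebra_simps)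
      show ?thesis
        unfolding ts H_def e_def prod.case inner_exp_imaginary_unit[OF I] *
        by (simp add: algebra_simps)
    qed
    then have "has_bochner_integral lborel (\<lambda>\<omega>. H (\<omega>, ts))
       (c * sqrt (2 * pi) * exp (- ((c * b)\<^sup>2 / 2)) * (g t \<bullet> g s) + 0 * ((I * g t) \<bullet> g s))"
      by (simp only:) (intro has_bochner_integral_add has_bochner_integral_mult_left G)
    moreover have "(c * b)\<^sup>2 = (c * (2 * pi * (t - s)))\<^sup>2"
      by (simp add: b_def power_mult_distrib power2_commute)
    ultimately show ?thesis
      by (simp add: has_bochner_integral_iff ts k_def)
  qed
  \<comment> \<open>\<open>k\<close> is the Fourier transform of \<open>w\<close>: it concentrates
    at 0 as \<open>c\<close> grows, but its mass stays one. Hence the final bound does not depend on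
    \<open>c\<close>.\<close>
  have "has_bochner_integral lborel k 1"
    unfolding k_def
  proof (rule has_bochner_integral_mult_right[where x="1 / (c * sqrt (2 * pi))", THEN has_bochner_integral_cong[THEN iffD1, rotated -1]])
    show "has_bochner_integral lborel (\<lambda>u. exp (- ((c * (2 * pi * u))\<^sup>2 / 2))) (1 / (c * sqrt (2 * pi)))"
    proof -
      have e1: "sqrt (2 * pi * c\<^sup>2) = c * sqrt (2 * pi)"
        using c by (simp add: real_sqrt_mult)
      have e2: "pi * (2 * pi * c\<^sup>2) * (0 - u)\<^sup>2 = (c * (2 * pi * u))\<^sup>2 / 2" for u
        by (simp add: power2_eq_square)
      show ?thesis
        using has_bochner_integral_gaussian[of "2 * pi * c\<^sup>2" 0] c unfolding e1 e2 by simp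
    qed
  qed (use c in auto)
  then have k: "integrable lborel k" "(LBINT u. k u) = 1"
    by (simp_all add: has_bochner_integral_iff)
  define N where "N = (LBINT t. (norm (g t))\<^sup>2)"
  have conv: "has_bochner_integral lborel
     (\<lambda>ts. ((case ts of (t, s) \<Rightarrow> (norm (g t))\<^sup>2 * k (t - s)) + (case ts of (t, s) \<Rightarrow> (norm (g s))\<^sup>2 * k (t - s))) * (1/2))
     ((N * 1 + N * 1) * (1/2))"
    unfolding N_def k(2)[symmetric]
    by (intro has_bochner_integral_mult_left has_bochner_integral_add has_bochner_integral_convolution g2 k(1))
  have k_nonneg: "k u \<ge> 0" for u
    using c by (simp add: k_def)
  have "(LBINT \<omega>. w \<omega> * (norm (E \<omega>))\<^sup>2) = (LBINT ts. (case ts of (t, s) \<Rightarrow> (g t \<bullet> g s) * k (t - s)))"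
    using lborel_pair.Fubini_integral[of "\<lambda>\<omega> ts. H (\<omega>, ts)"] H_int'
    by (simp add: H_fst H_snd)
  also have "\<dots> \<le> (LBINT ts. ((case ts of (t, s) \<Rightarrow> (norm (g t))\<^sup>2 * k (t - s)) + (case ts of (t, s) \<Rightarrow> (norm (g s))\<^sup>2 * k (t - s))) * (1/2))"
  proof (rule integral_mono)
    show "integrable lborel (\<lambda>ts. (case ts of (t, s) \<Rightarrow> (g t \<bullet> g s) * k (t - s)))"
      using lborel_pair.integrable_snd[of "\<lambda>\<omega> ts. H (\<omega>, ts)"] H_int'
      by (simp add: H_snd)
    show "integrable lborel (\<lambda>ts. ((case ts of (t, s) \<Rightarrow> (norm (g t))\<^sup>2 * k (t - s)) + (case ts of (t, s) \<Rightarrow> (norm (g s))\<^sup>2 * k (t - s))) * (1/2))"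
      using conv by (simp only: has_bochner_integral_iff)
    fix ts :: "real \<times> real"
    obtain t s where ts: "ts = (t, s)" by force
    have "g t \<bullet> g s \<le> ((norm (g t))\<^sup>2 + (norm (g s))\<^sup>2) / 2"
      using inner_ge_zero[of "g t - g s"]
      by (simp add: power2_norm_eq_inner inner_diff_left inner_diff_right inner_commute)
    then have "(g t \<bullet> g s) * k (t - s) \<le> ((norm (g t))\<^sup>2 + (norm (g s))\<^sup>2) / 2 * k (t - s)"
      by (rule mult_right_mono) (rule k_nonneg)
    then show "(case ts of (t, s) \<Rightarrow> (g t \<bullet> g s) * k (t - s)) \<le> ((case ts of (t, s) \<Rightarrow> (norm (g t))\<^sup>2 * k (t - s)) + (case ts of (t, s) \<Rightarrow> (norm (g s))\<^sup>2 * k (t - s))) * (1/2)"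
      by (simp add: ts field_simps)
  qed
  also have "\<dots> = N"
    using conv by (simp only: has_bochner_integral_iff) simp
  finally have "(LBINT \<omega>. w \<omega> * (norm (E \<omega>))\<^sup>2) \<le> N" .
  moreover have "(\<integral>\<^sup>+\<omega>. ennreal (w \<omega> * (norm (E \<omega>))\<^sup>2) \<partial>lborel) = ennreal (LBINT \<omega>. w \<omega> * (norm (E \<omega>))\<^sup>2)"
    using lborel_pair.integrable_fst'[OF H_int']
    by (intro nn_integral_eq_integral) (auto simp: H_fst w_def)
  ultimately show ?thesis
    unfolding N_def E_def e_def w_def by (simp add: ennreal_leI)
qed

text \<open>The regularized bound is uniform in the width \<open>c\<close>, and the weights increase
  to 1 as \<open>c\<close> tends to infinity, so monotone convergence removes them.\<close>

lemma fourier_bessel: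
  fixes g :: "real \<Rightarrow> quat"
  assumes I: "I \<in> imaginary_units"
    and g1: "integrable lborel g" and g2: "integrable lborel (\<lambda>t. (norm (g t))\<^sup>2)"
  shows "(\<integral>\<^sup>+\<omega>. ennreal ((norm (LBINT t. exp ((- (2 * pi * \<omega> * t)) *\<^sub>R I) * g t))\<^sup>2) \<partial>lborel)
      \<le> ennreal (LBINT t. (norm (g t))\<^sup>2)"
proof -
  note [measurable] = borel_measurable_integrable[OF g1]
  have [measurable]: "(\<lambda>x. exp (x *\<^sub>R I)) \<in> borel_measurable borel"
    unfolding exp_imaginary_unit[OF I] of_real_def by measurable
  define E where "E \<omega> = (LBINT t. exp ((- (2 * pi * \<omega> * t)) *\<^sub>R I) * g t)" for \<omega>
  have [measurable]: "E \<in> borel_measurable borel"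
    unfolding E_def by measurable
  \<comment> \<open>The width is \<open>Suc n\<close> rather than \<open>n\<close> because the
    regularized inequality requires a positive one.\<close>
  define F where "F n \<omega> = ennreal (exp (- ((\<omega> / real (Suc n))\<^sup>2 / 2)) * (norm (E \<omega>))\<^sup>2)" for n \<omega>
  have "(\<lambda>n. \<integral>\<^sup>+\<omega>. F n \<omega> \<partial>lborel) \<longlonglongrightarrow> (\<integral>\<^sup>+\<omega>. ennreal ((norm (E \<omega>))\<^sup>2) \<partial>lborel)"
  proof (rule nn_integral_LIMSEQ)
    show "incseq F"
    proof (rule incseq_SucI, rule le_funI)
      fix n \<omega>
      have "\<bar>\<omega> / real (Suc (Suc n))\<bar> \<le> \<bar>\<omega> / real (Suc n)\<bar>"
        by (simp add: frac_le)
      then have "(\<omega> / real (Suc (Suc n)))\<^sup>2 \<le> (\<omega> / real (Suc n))\<^sup>2"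
        by (simp only: abs_le_square_iff)
      then show "F n \<omega> \<le> F (Suc n) \<omega>"
        unfolding F_def by (intro ennreal_leI mult_right_mono) auto
    qed
    show "F n \<in> borel_measurable lborel" for n
      unfolding F_def by measurable
    fix \<omega> :: real
    have "(\<lambda>n. exp (- ((\<omega> * inverse (real (Suc n)))\<^sup>2 / 2)) * (norm (E \<omega>))\<^sup>2)
        \<longlonglongrightarrow> exp (- ((\<omega> * 0)\<^sup>2 / 2)) * (norm (E \<omega>))\<^sup>2"
      by (intro tendsto_intros LIMSEQ_inverse_real_of_nat) simp
    then show "(\<lambda>n. F n \<omega>) \<longlonglongrightarrow> ennreal ((norm (E \<omega>))\<^sup>2)"
      unfolding F_def divide_inverse[of \<omega>] by (intro tendsto_ennrealI) simp
  qed
  moreover have "(\<integral>\<^sup>+\<omega>. F n \<omega> \<partial>lborel) \<le> ennreal (LBINT t. (norm (g t))\<^sup>2)" for n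
    unfolding F_def E_def by (rule regularized_fourier_bessel[OF I g1 g2]) simp
  ultimately show ?thesis
    unfolding E_def by (intro LIMSEQ_le_const2) auto
qed

section \<open>Borel representatives and Cauchy--Schwarz\<close>

text \<open>The real case is applied to each coordinate and the results are reassembled; the basis
  is finite, so the exceptional null sets combine.\<close>

lemma completion_ex_borel_measurable_euclidean:
  fixes f :: "'a \<Rightarrow> 'b::euclidean_space"
  assumes f: "f \<in> borel_measurable (completion M)"
  shows "\<exists>f'\<in>borel_measurable M. AE x in M. f x = f' x"
proof -
  have "\<exists>h\<in>borel_measurable M. AE x in M. f x \<bullet> b = h x" for b
    by (intro completion_ex_borel_measurable_real borel_measurable_inner f borel_measurable_const)
  then obtain h where h: "\<And>b. h b \<in> borel_measurable M" "\<And>b. AE x in M. f x \<bullet> b = h b x"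
    by metis
  note [measurable] = h(1)
  have "AE x in M. \<forall>b\<in>Basis. f x \<bullet> b = h b x"
    by (simp add: AE_finite_all h(2))
  then have "AE x in M. f x = (\<Sum>b\<in>Basis. h b x *\<^sub>R b)"
  proof eventually_elim
    fix x assume *: "\<forall>b\<in>Basis. f x \<bullet> b = h b x"
    have "(\<Sum>b\<in>Basis. h b x *\<^sub>R b) = (\<Sum>b\<in>Basis. (f x \<bullet> b) *\<^sub>R b)"
      using * by (intro sum.cong) auto
    then show "f x = (\<Sum>b\<in>Basis. h b x *\<^sub>R b)"
      by (simp add: euclidean_representation)
  qed
  then show ?thesis
    by (intro bexI[where x="\<lambda>x. \<Sum>b\<in>Basis. h b x *\<^sub>R b"]) auto
qed

lemma integrable_mult_square:
  fixes u v :: "'a \<Rightarrow> real"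
  assumes [measurable]: "u \<in> borel_measurable M" "v \<in> borel_measurable M"
    and u: "integrable M (\<lambda>x. (u x)\<^sup>2)" and v: "integrable M (\<lambda>x. (v x)\<^sup>2)"
  shows "integrable M (\<lambda>x. u x * v x)"
proof (rule Bochner_Integration.integrable_bound[OF Bochner_Integration.integrable_add[OF u v]])
  have "\<bar>a * b\<bar> \<le> a\<^sup>2 + b\<^sup>2" for a b :: real
  proof -
    have "2 * (\<bar>a\<bar> * \<bar>b\<bar>) \<le> a\<^sup>2 + b\<^sup>2"
      using sum_squares_bound[of "\<bar>a\<bar>" "\<bar>b\<bar>"] by simp
    moreover have "0 \<le> \<bar>a\<bar> * \<bar>b\<bar>" by simp
    ultimately show ?thesis unfolding abs_mult by linarith
  qed
  then show "AE x in M. norm (u x * v x) \<le> norm ((u x)\<^sup>2 + (v x)\<^sup>2)"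
    by simp
qed simp

text \<open>Transferred from the inequality for nonnegative integrals. Pointwise nonnegativity lets
  \<open>ennreal\<close> pass through the products, and it is available where the lemma is used, on
  a Gaussian and a norm.\<close>

lemma Cauchy_Schwarz_integral:
  fixes u v :: "'a \<Rightarrow> real"
  assumes [measurable]: "u \<in> borel_measurable M" "v \<in> borel_measurable M"
    and u: "integrable M (\<lambda>x. (u x)\<^sup>2)" and v: "integrable M (\<lambda>x. (v x)\<^sup>2)"
    and nn: "\<And>x. 0 \<le> u x" "\<And>x. 0 \<le> v x"
  shows "(LINT x|M. u x * v x)\<^sup>2 \<le> (LINT x|M. (u x)\<^sup>2) * (LINT x|M. (v x)\<^sup>2)"
proof -
  have "ennreal ((LINT x|M. u x * v x)\<^sup>2) = (\<integral>\<^sup>+x. ennreal (u x) * ennreal (v x) \<partial>M)\<^sup>2"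
    using integrable_mult_square[OF assms(1-4)] nn
    by (simp add: nn_integral_eq_integral ennreal_mult[symmetric] ennreal_power)
  also have "\<dots> \<le> (\<integral>\<^sup>+x. (ennreal (u x))\<^sup>2 \<partial>M) * (\<integral>\<^sup>+x. (ennreal (v x))\<^sup>2 \<partial>M)"
    by (rule Cauchy_Schwarz_nn_integral) measurable
  also have "\<dots> = ennreal ((LINT x|M. (u x)\<^sup>2) * (LINT x|M. (v x)\<^sup>2))"
    using u v nn by (simp add: nn_integral_eq_integral ennreal_mult ennreal_power)
  finally show ?thesis by (simp add: mult_nonneg_nonneg)
qed

section \<open>The short-time transform as a windowed Fourier integral\<close>

text \<open>The exponent lies in the commutative plane spanned by 1 and \<open>I\<close>, so its
  exponential splits. Completing the square in the real part leaves the Gaussian window centred at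
  \<open>x\<close> and a factor in \<open>norm q\<close>; that factor and the phase in
  \<open>x * \<omega>\<close> are the ones that the definition of \<open>qstft\<close>
  cancels.\<close>

lemma segal_bargmann_kernel:
  assumes I: "I \<in> imaginary_units" and q: "q = of_real x + I * of_real \<omega>"
  shows "exp (- (pi *\<^sub>R ((qcnj q /\<^sub>R sqrt 2)\<^sup>2 + of_real (t\<^sup>2))) + (2 * pi * sqrt 2 * t) *\<^sub>R (qcnj q /\<^sub>R sqrt 2))
    = (exp (pi * (norm q)\<^sup>2 / 2) * exp (- (pi * (x - t)\<^sup>2))) *\<^sub>R
      (exp ((pi * x * \<omega>) *\<^sub>R I) * exp ((- (2 * pi * \<omega> * t)) *\<^sub>R I))"
proof -
  note II = imaginary_unit_square[OF I]
  have nq: "(norm q)\<^sup>2 = x\<^sup>2 + \<omega>\<^sup>2"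
  proof -
    have "(norm q)\<^sup>2 = x\<^sup>2 + ((qim1 I)\<^sup>2 + (qim2 I)\<^sup>2 + (qim3 I)\<^sup>2) * \<omega>\<^sup>2"
      using imaginary_unit_re[OF I]
      by (simp add: q norm_quat_eq of_real_def quat_times_sel power_mult_distrib distrib_right)
    moreover have "(qim1 I)\<^sup>2 + (qim2 I)\<^sup>2 + (qim3 I)\<^sup>2 = 1"
      using imaginary_unit_re[OF I] imaginary_unit_norm[OF I] by (simp add: norm_quat_eq)
    ultimately show ?thesis by simp
  qed
  have cq: "qcnj q = x *\<^sub>R 1 - \<omega> *\<^sub>R I"
    using imaginary_unit_re[OF I] unfolding q
    by (simp add: quat_eq_iff qcnj_def of_real_def)
  have sq: "(qcnj q /\<^sub>R sqrt 2)\<^sup>2 = ((x\<^sup>2 - \<omega>\<^sup>2) / 2) *\<^sub>R 1 - (x * \<omega>) *\<^sub>R I"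
  proof -
    have "(qcnj q /\<^sub>R sqrt 2)\<^sup>2 = (1 / 2) *\<^sub>R (qcnj q * qcnj q)"
      by (simp add: scaleR_power power_inverse power2_eq_square[of "qcnj q"])
    also have "qcnj q * qcnj q = (x\<^sup>2 - \<omega>\<^sup>2) *\<^sub>R 1 - (x * \<omega>) *\<^sub>R I - (x * \<omega>) *\<^sub>R I"
      unfolding cq by (simp add: II power2_eq_square algebra_simps)
    finally show ?thesis
      by (rule trans) (simp add: quat_eq_iff field_simps)
  qed
  have lin: "(2 * pi * sqrt 2 * t) *\<^sub>R (qcnj q /\<^sub>R sqrt 2) = (2 * pi * t * x) *\<^sub>R 1 - (2 * pi * t * \<omega>) *\<^sub>R I"
  proof -
    have "2 * pi * sqrt 2 * t * (inverse (sqrt 2) * y) = 2 * pi * t * y" for y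
      by (simp add: field_simps)
    then show ?thesis by (simp only: cq scaleR_diff_right scaleR_scaleR)
  qed
  define a where "a = pi * (norm q)\<^sup>2 / 2 - pi * (x - t)\<^sup>2"
  define b where "b = pi * x * \<omega> - 2 * pi * \<omega> * t"
  have "- (pi *\<^sub>R ((qcnj q /\<^sub>R sqrt 2)\<^sup>2 + of_real (t\<^sup>2))) + (2 * pi * sqrt 2 * t) *\<^sub>R (qcnj q /\<^sub>R sqrt 2)
      = (- pi * ((x\<^sup>2 - \<omega>\<^sup>2) / 2 + t\<^sup>2) + 2 * pi * t * x) *\<^sub>R 1 + b *\<^sub>R I"
    unfolding sq lin of_real_def b_def
    by (simp add: quat_eq_iff field_simps)
  also have "- pi * ((x\<^sup>2 - \<omega>\<^sup>2) / 2 + t\<^sup>2) + 2 * pi * t * x = a"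
    unfolding a_def nq by (simp add: field_simps power2_eq_square)
  finally have *: "exp (- (pi *\<^sub>R ((qcnj q /\<^sub>R sqrt 2)\<^sup>2 + of_real (t\<^sup>2))) + (2 * pi * sqrt 2 * t) *\<^sub>R (qcnj q /\<^sub>R sqrt 2))
      = exp (of_real a + b *\<^sub>R I)"
    by (simp add: of_real_def)
  have "exp (of_real a + b *\<^sub>R I) = exp (of_real a) * exp (b *\<^sub>R I)"
    by (rule exp_add_commuting) (simp add: of_real_def)
  moreover have "exp (b *\<^sub>R I) = exp ((pi * x * \<omega>) *\<^sub>R I) * exp ((- (2 * pi * \<omega> * t)) *\<^sub>R I)"
    by (subst exp_add_commuting[symmetric]) (simp_all add: b_def scaleR_diff_left)
  moreover have "exp (of_real a :: quat) = (exp (pi * (norm q)\<^sup>2 / 2) * exp (- (pi * (x - t)\<^sup>2))) *\<^sub>R 1"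
    unfolding exp_of_real a_def by (simp add: of_real_def flip: exp_add)
  ultimately show ?thesis unfolding * by simp
qed

lemma powr_three_quarters_square: "(2 powr (3/4))\<^sup>2 = 2 * sqrt 2"
proof -
  have "(2 powr (3/4))\<^sup>2 = (2::real) powr (1 + 1/2)"
    by (simp add: power2_eq_square flip: powr_add)
  also have "\<dots> = 2 * sqrt 2"
    by (simp only: powr_add) (simp add: powr_half_sqrt)
  finally show ?thesis .
qed

lemma qstft_eq:
  fixes f g :: "real \<Rightarrow> quat"
  assumes I: "I \<in> imaginary_units" and f: "f \<in> borel_measurable lebesgue"
    and [measurable]: "g \<in> borel_measurable lborel" and fg: "AE t in lborel. f t = g t"
    and g2: "integrable lborel (\<lambda>t. (norm (g t))\<^sup>2)"
  shows "qstft I f x \<omega> = (2 powr (3/4)) *\<^sub>R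
    (LBINT t. exp ((- (2 * pi * \<omega> * t)) *\<^sub>R I) * (exp (- (pi * (x - t)\<^sup>2)) *\<^sub>R g t))"
proof -
  define q where "q = of_real x + I * of_real \<omega>"
  define h where "h t = exp ((- (2 * pi * \<omega> * t)) *\<^sub>R I) * (exp (- (pi * (x - t)\<^sup>2)) *\<^sub>R g t)" for t
  \<comment> \<open>\<open>A\<close> collects the kernel factors independent of \<open>t\<close>. It
    stands to the left of \<open>h\<close>, so it can be pulled out of the integral without
    commuting anything past \<open>f\<close>.\<close>
  define A where "A = (2 powr (3/4) * exp (pi * (norm q)\<^sup>2 / 2)) *\<^sub>R exp ((pi * x * \<omega>) *\<^sub>R I)"
  have [measurable]: "(\<lambda>x. exp (x *\<^sub>R I)) \<in> borel_measurable borel"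
    unfolding exp_imaginary_unit[OF I] of_real_def by measurable
  have h_meas [measurable]: "h \<in> borel_measurable lborel"
    unfolding h_def by measurable
  have h: "integrable lborel h"
  proof (rule Bochner_Integration.integrable_bound)
    show "integrable lborel (\<lambda>t. exp (- (pi * (x - t)\<^sup>2)) * norm (g t))"
    proof (rule integrable_mult_square)
      show "integrable lborel (\<lambda>t. (exp (- (pi * (x - t)\<^sup>2)))\<^sup>2)"
        using has_bochner_integral_gaussian_square by (simp only: has_bochner_integral_iff)
    qed (use g2 in simp_all)
    show "AE t in lborel. norm (h t) \<le> norm (exp (- (pi * (x - t)\<^sup>2)) * norm (g t))"
      unfolding h_def norm_mult norm_exp_imaginary_unit[OF I] by simp
  qed (rule h_meas)
  have "segal_bargmann f (qcnj q /\<^sub>R sqrt 2) = (LINT t|lebesgue. A * h t)"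
    unfolding segal_bargmann_def
  proof (rule integral_cong_AE)
    show "AE t in lebesgue. (2 powr (3/4)) *\<^sub>R
          exp (- (pi *\<^sub>R ((qcnj q /\<^sub>R sqrt 2)\<^sup>2 + of_real (t\<^sup>2))) +
            (2 * pi * sqrt 2 * t) *\<^sub>R (qcnj q /\<^sub>R sqrt 2)) * f t = A * h t"
    proof -
      have *: "(c *\<^sub>R ((a * b) *\<^sub>R (X * Y))) * Z = ((c * a) *\<^sub>R X) * (Y * (b *\<^sub>R Z))" for a b c and X Y Z :: quat
        by (simp add: mult.assoc)
      show ?thesis
        using fg[THEN AE_completion]
        by eventually_elim
           (simp only: segal_bargmann_kernel[OF I q_def] A_def h_def, simp only: *)
    qed
    show "(\<lambda>t. A * h t) \<in> borel_measurable lebesgue"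
      using h_meas by (intro measurable_completion) measurable
    have "(\<lambda>t. (2 powr (3/4)) *\<^sub>R
          exp (- (pi *\<^sub>R ((qcnj q /\<^sub>R sqrt 2)\<^sup>2 + of_real (t\<^sup>2))) +
            (2 * pi * sqrt 2 * t) *\<^sub>R (qcnj q /\<^sub>R sqrt 2))) \<in> borel_measurable lebesgue"
      unfolding segal_bargmann_kernel[OF I q_def] by (intro measurable_completion) measurable
    then show "(\<lambda>t. (2 powr (3/4)) *\<^sub>R
          exp (- (pi *\<^sub>R ((qcnj q /\<^sub>R sqrt 2)\<^sup>2 + of_real (t\<^sup>2))) +
            (2 * pi * sqrt 2 * t) *\<^sub>R (qcnj q /\<^sub>R sqrt 2)) * f t) \<in> borel_measurable lebesgue"
      by (intro borel_measurable_times f)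
  qed
  also have "\<dots> = (LBINT t. A * h t)"
    using h_meas by (intro integral_completion) measurable
  also have "\<dots> = A * (LBINT t. h t)"
    using h by simp
  finally have "qstft I f x \<omega> = exp (- (pi * x * \<omega>) *\<^sub>R I) * (A * (LBINT t. h t)) * of_real (exp (- (pi * (norm q)\<^sup>2 / 2)))"
    by (simp add: qstft_def q_def Let_def)
  \<comment> \<open>The trailing factor of \<open>qstft\<close> is real, hence central, and meets
    its reciprocal in \<open>A\<close>; the two opposite phases are already adjacent on the
    left.\<close>
  also have "\<dots> = (2 powr (3/4) * (exp (pi * (norm q)\<^sup>2 / 2) * exp (- (pi * (norm q)\<^sup>2 / 2)))) *\<^sub>R
      ((exp (- ((pi * x * \<omega>) *\<^sub>R I)) * exp ((pi * x * \<omega>) *\<^sub>R I)) * (LBINT t. h t))"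
    unfolding A_def of_real_def by (simp add: mult.assoc ac_simps)
  also have "\<dots> = (2 powr (3/4)) *\<^sub>R (LBINT t. h t)"
    using exp_minus_inverse[of "- ((pi * x * \<omega>) *\<^sub>R I)"] by (simp add: exp_minus)
  finally show ?thesis by (simp add: h_def)
qed

section \<open>Uniform bound, square integral and interpolation\<close>

theorem theorem5p14:
  fixes I :: quat and f :: "real \<Rightarrow> quat" and p :: real
  assumes "I \<in> imaginary_units"
    and "square_integrable f"
    and "2 \<le> p"
  shows "integrable lebesgue (\<lambda>(x, \<omega>). norm (qstft I f x \<omega>) powr p) \<and>
    (LINT (x, \<omega>)|lebesgue. norm (qstft I f x \<omega>) powr p)
      \<le> 2 powr (p + 1) / p * L2_norm f powr p"
proof -
  note I = assms(1) and p = assms(3)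
  have f: "f \<in> borel_measurable lebesgue" "integrable lebesgue (\<lambda>t. (norm (f t))\<^sup>2)"
    using assms(2) by (auto simp: square_integrable_def)
  \<comment> \<open>\<open>f\<close> is only Lebesgue measurable; a Borel representative makes the
    integrands jointly measurable for the product of \<open>lborel\<close> with itself, as Tonelli
    requires.\<close>
  obtain g where g[measurable]: "g \<in> borel_measurable lborel" and fg: "AE t in lborel. f t = g t"
    using completion_ex_borel_measurable_euclidean[OF f(1)] by blast
  define N where "N = (LBINT t. (norm (g t))\<^sup>2)"
  have fg': "AE t in lebesgue. (norm (f t))\<^sup>2 = (norm (g t))\<^sup>2"
    using fg[THEN AE_completion] by eventually_elim simp
  have ng: "(\<lambda>t. (norm (g t))\<^sup>2) \<in> borel_measurable lborel" by measurable
  have ng': "(\<lambda>t. (norm (g t))\<^sup>2) \<in> borel_measurable lebesgue"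
    using ng by (rule measurable_completion)
  have nf: "(\<lambda>t. (norm (f t))\<^sup>2) \<in> borel_measurable lebesgue"
    using f(2) by (rule borel_measurable_integrable)
  have g2: "integrable lborel (\<lambda>t. (norm (g t))\<^sup>2)"
    using f(2) integrable_cong_AE[OF nf ng' fg'] integrable_completion[OF ng] by simp
  have N: "L2_norm f = sqrt N" "N \<ge> 0"
    unfolding L2_norm_def N_def
    using integral_cong_AE[OF nf ng' fg'] integral_completion[OF ng] by simp_all
  have [measurable]: "(\<lambda>x. exp (x *\<^sub>R I)) \<in> borel_measurable borel"
    unfolding exp_imaginary_unit[OF I] of_real_def by measurable
  define G where "G x t = exp (- (pi * (x - t)\<^sup>2)) *\<^sub>R g t" for x t
  define E where "E x \<omega> = (LBINT t. exp ((- (2 * pi * \<omega> * t)) *\<^sub>R I) * G x t)" for x \<omega>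
  have V: "qstft I f x \<omega> = (2 powr (3/4)) *\<^sub>R E x \<omega>" for x \<omega>
    unfolding E_def G_def by (rule qstft_eq[OF I f(1) g fg g2])
  have [measurable]: "(\<lambda>(x, t). G x t) \<in> borel_measurable (borel \<Otimes>\<^sub>M borel)"
    unfolding G_def by measurable
  have E_meas: "(\<lambda>(x, \<omega>). E x \<omega>) \<in> borel_measurable (borel \<Otimes>\<^sub>M borel)"
    unfolding E_def by measurable
  note [measurable] = E_meas
  have gauss: "integrable lborel (\<lambda>t. (exp (- (pi * (x - t)\<^sup>2)))\<^sup>2)"
      "(LBINT t. (exp (- (pi * (x - t)\<^sup>2)))\<^sup>2) = 1 / sqrt 2" for x
    using has_bochner_integral_gaussian_square by (simp_all only: has_bochner_integral_iff)
  have G_norm: "norm (G x t) = exp (- (pi * (x - t)\<^sup>2)) * norm (g t)" for x t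
    by (simp add: G_def)
  have G1: "integrable lborel (G x)" for x
  proof -
    have "integrable lborel (\<lambda>t. norm (G x t))"
      unfolding G_norm by (rule integrable_mult_square) (use gauss g2 in simp_all)
    then show ?thesis by (rule integrable_norm_cancel) measurable
  qed
  \<comment> \<open>With the squared window as \<open>k\<close>, the function
    \<open>(norm (G x t))\<^sup>2\<close> becomes a convolution integrand, whose integral over
    \<open>x\<close> and \<open>t\<close> is \<open>N / sqrt 2\<close>.\<close>
  define k where "k u = (exp (- (pi * u\<^sup>2)))\<^sup>2" for u :: real
  have k: "integrable lborel k" "(LBINT u. k u) = 1 / sqrt 2"
    using gauss[of 0] by (simp_all add: k_def[abs_def])
  have G_sq: "(norm (G x t))\<^sup>2 = (norm (g t))\<^sup>2 * k (x - t)" for x t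
    by (simp add: G_norm k_def power_mult_distrib)
  have G2: "integrable lborel (\<lambda>t. (norm (G x t))\<^sup>2)" for x
  proof (rule Bochner_Integration.integrable_bound[OF g2])
    show "AE t in lborel. norm ((norm (G x t))\<^sup>2) \<le> norm ((norm (g t))\<^sup>2)"
      by (simp add: G_sq k_def mult_left_le power_le_one)
  qed measurable
  \<comment> \<open>Here \<open>M\<^sup>2 = 2 * N\<close>: the normalisation contributes
    \<open>2 * sqrt 2\<close> and the squared window \<open>1 / sqrt 2\<close>. The square integral
    below has the same bound \<open>2 * N\<close>, so interpolation yields exactly
    \<open>M powr p\<close>.\<close>
  define M where "M = sqrt 2 * sqrt N"
  have V_bound: "norm (qstft I f x \<omega>) \<le> M" for x \<omega>
  proof -
    have "norm (E x \<omega>) \<le> (LBINT t. norm (exp ((- (2 * pi * \<omega> * t)) *\<^sub>R I) * G x t))"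
      unfolding E_def by (rule integral_norm_bound)
    also have "\<dots> = (LBINT t. exp (- (pi * (x - t)\<^sup>2)) * norm (g t))"
      unfolding norm_mult norm_exp_imaginary_unit[OF I] G_norm by simp
    finally have "(norm (E x \<omega>))\<^sup>2 \<le> (LBINT t. exp (- (pi * (x - t)\<^sup>2)) * norm (g t))\<^sup>2"
      by (intro power_mono) auto
    also have "\<dots> \<le> (1 / sqrt 2) * N"
      unfolding N_def gauss(2)[of x, symmetric]
      by (rule Cauchy_Schwarz_integral) (use gauss g2 in simp_all)
    finally have "(norm (E x \<omega>))\<^sup>2 \<le> (1 / sqrt 2) * N" .
    then have "2 * sqrt 2 * (norm (E x \<omega>))\<^sup>2 \<le> 2 * sqrt 2 * ((1 / sqrt 2) * N)"
      by (rule mult_left_mono) simp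
    then have "(norm (qstft I f x \<omega>))\<^sup>2 \<le> 2 * sqrt 2 * ((1 / sqrt 2) * N)"
      by (simp only: V norm_scaleR power_mult_distrib power2_abs powr_three_quarters_square)
    also have "\<dots> = M\<^sup>2"
      using N(2) by (simp add: M_def power_mult_distrib)
    finally show ?thesis
      by (rule power2_le_imp_le) (simp add: M_def N(2))
  qed
  have V_sq: "(\<integral>\<^sup>+x. \<integral>\<^sup>+\<omega>. ennreal ((norm (qstft I f x \<omega>))\<^sup>2) \<partial>lborel \<partial>lborel) \<le> ennreal (2 * N)"
  proof -
    have conv: "integrable lborel (\<lambda>(x, t). (norm (G x t))\<^sup>2)"
        "(LBINT xt. (case xt of (x, t) \<Rightarrow> (norm (G x t))\<^sup>2)) = N / sqrt 2"
      using has_bochner_integral_convolution(2)[OF g2 k(1)]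
      by (simp_all add: has_bochner_integral_iff G_sq N_def k(2))
    then have i: "integrable (lborel \<Otimes>\<^sub>M lborel) (\<lambda>(x, t). (norm (G x t))\<^sup>2)"
      by (simp add: lborel_prod)
    have "(\<integral>\<^sup>+x. \<integral>\<^sup>+\<omega>. ennreal ((norm (qstft I f x \<omega>))\<^sup>2) \<partial>lborel \<partial>lborel)
       = (\<integral>\<^sup>+x. ennreal (2 * sqrt 2) * (\<integral>\<^sup>+\<omega>. ennreal ((norm (E x \<omega>))\<^sup>2) \<partial>lborel) \<partial>lborel)"
      by (intro nn_integral_cong)
         (simp add: V power_mult_distrib powr_three_quarters_square ennreal_mult nn_integral_cmult)
    \<comment> \<open>Bessel's inequality is applied in \<omega> to the windowed signal
      \<open>G x\<close>, for each fixed \<open>x\<close>.\<close>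
    also have "\<dots> \<le> (\<integral>\<^sup>+x. ennreal (2 * sqrt 2) * ennreal (LBINT t. (norm (G x t))\<^sup>2) \<partial>lborel)"
      unfolding E_def by (intro nn_integral_mono mult_left_mono fourier_bessel I G1 G2) simp
    also have "\<dots> = ennreal (2 * sqrt 2) * (\<integral>\<^sup>+x. ennreal (LBINT t. (norm (G x t))\<^sup>2) \<partial>lborel)"
      by (intro nn_integral_cmult) measurable
    also have "(\<integral>\<^sup>+x. ennreal (LBINT t. (norm (G x t))\<^sup>2) \<partial>lborel) = ennreal (LBINT x. LBINT t. (norm (G x t))\<^sup>2)"
      using lborel_pair.integrable_fst'[OF i] by (intro nn_integral_eq_integral) auto
    also have "(LBINT x. LBINT t. (norm (G x t))\<^sup>2) = N / sqrt 2"
      using lborel_pair.integral_fst'[OF i] conv(2) by (simp add: lborel_prod)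
    also have "ennreal (2 * sqrt 2) * ennreal (N / sqrt 2) = ennreal (2 * N)"
      using N(2) by (subst ennreal_mult[symmetric]) auto
    finally show ?thesis .
  qed
  define W where "W = (\<lambda>(x, \<omega>). norm (qstft I f x \<omega>) powr p)"
  have "W \<in> borel_measurable (borel \<Otimes>\<^sub>M borel)"
    unfolding W_def V by measurable
  then have W_meas: "W \<in> borel_measurable lborel"
    by (simp add: borel_prod)
  \<comment> \<open>Interpolation is pointwise: the power \<open>p - 2\<close>, nonnegative by
    assumption, is estimated by the uniform bound and the remaining square is kept. At a zero of the
    transform the left side is \<open>0 powr p = 0\<close>.\<close>
  have W_le: "W (x, \<omega>) \<le> M powr (p - 2) * (norm (qstft I f x \<omega>))\<^sup>2" for x \<omega>
  proof (cases "qstft I f x \<omega> = 0")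
    case False
    then have "W (x, \<omega>) = norm (qstft I f x \<omega>) powr (p - 2) * (norm (qstft I f x \<omega>))\<^sup>2"
      by (simp add: W_def flip: powr_numeral powr_add)
    also have "\<dots> \<le> M powr (p - 2) * (norm (qstft I f x \<omega>))\<^sup>2"
      using p V_bound by (intro mult_right_mono powr_mono2) auto
    finally show ?thesis .
  qed (simp add: W_def)
  have "(\<integral>\<^sup>+z. ennreal (W z) \<partial>lborel) = (\<integral>\<^sup>+x. \<integral>\<^sup>+\<omega>. ennreal (W (x, \<omega>)) \<partial>lborel \<partial>lborel)"
    using W_meas by (subst lborel.nn_integral_fst) (simp_all add: lborel_prod)
  also have "\<dots> \<le> (\<integral>\<^sup>+x. \<integral>\<^sup>+\<omega>. ennreal (M powr (p - 2)) * ennreal ((norm (qstft I f x \<omega>))\<^sup>2) \<partial>lborel \<partial>lborel)"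
    by (intro nn_integral_mono) (simp add: W_le flip: ennreal_mult)
  also have "\<dots> = ennreal (M powr (p - 2)) * (\<integral>\<^sup>+x. \<integral>\<^sup>+\<omega>. ennreal ((norm (qstft I f x \<omega>))\<^sup>2) \<partial>lborel \<partial>lborel)"
  proof -
    have 1: "(\<lambda>\<omega>. ennreal ((norm (qstft I f x \<omega>))\<^sup>2)) \<in> borel_measurable lborel" for x
      unfolding V by measurable
    have 2: "(\<lambda>x. \<integral>\<^sup>+\<omega>. ennreal ((norm (qstft I f x \<omega>))\<^sup>2) \<partial>lborel) \<in> borel_measurable lborel"
      unfolding V by measurable
    show ?thesis by (simp only: nn_integral_cmult[OF 1] nn_integral_cmult[OF 2])
  qed
  also have "\<dots> \<le> ennreal (M powr (p - 2)) * ennreal (2 * N)"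
    by (intro mult_left_mono V_sq) simp
  also have "\<dots> = ennreal (M powr (p - 2) * (2 * N))"
    using N(2) by (simp add: ennreal_mult)
  finally have bound: "(\<integral>\<^sup>+z. ennreal (W z) \<partial>lborel) \<le> ennreal (M powr (p - 2) * (2 * N))" .
  have W_nonneg: "W z \<ge> 0" for z
    by (simp add: W_def split_beta')
  \<comment> \<open>A function that is not integrable has Bochner integral 0, so the inequality
    alone would say nothing about it; integrability follows from the finite bound on the nonnegative
    integral.\<close>
  have W_int: "integrable lborel W"
    using bound W_nonneg by (intro integrableI_nonneg W_meas) (auto intro: le_less_trans)
  have "(LBINT z. W z) \<le> M powr (p - 2) * (2 * N)"
    using bound N(2) W_nonneg by (simp add: nn_integral_eq_integral[OF W_int])
  also have "\<dots> = M powr (p - 2) * M\<^sup>2"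
    using N(2) by (simp add: M_def power_mult_distrib)
  also have "\<dots> = M powr p"
  proof (cases "M = 0")
    case False
    then have "M > 0" using N(2) by (simp add: M_def)
    then show ?thesis by (simp flip: powr_numeral powr_add)
  qed simp
  also have "\<dots> = 2 powr (p / 2) * L2_norm f powr p"
    unfolding M_def N(1) using N(2) by (simp add: powr_mult powr_powr flip: powr_half_sqrt)
  also have "\<dots> \<le> 2 powr (p + 1) / p * L2_norm f powr p"
  proof (rule mult_right_mono)
    \<comment> \<open>The claim reduces to \<open>p \<le> 2 * 2 powr (p / 2)\<close>. A linear lower
      bound for \<open>2 powr (p / 2)\<close> itself would be too weak for large \<open>p\<close>,
      so one for \<open>2 powr (p / 4)\<close>, namely \<open>1 + p / 6\<close>, is squared; its
      square is at least \<open>2 * p / 3\<close> and hence at least \<open>p / 2\<close>.\<close>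
    have "1 + p / 4 * (2 / 3) \<le> 1 + p / 4 * ln 2"
      using ln2_ge_two_thirds p by (intro add_left_mono mult_left_mono) auto
    also have "\<dots> \<le> 2 powr (p / 4)"
      by (simp add: powr_def exp_ge_add_one_self)
    finally have "(1 + p / 4 * (2 / 3))\<^sup>2 \<le> (2 powr (p / 4))\<^sup>2"
      using p by (intro power_mono) auto
    moreover have "(2 powr (p / 4))\<^sup>2 = (2::real) powr (p / 2)"
      by (simp add: power2_eq_square flip: powr_add)
    moreover have "p / 2 \<le> (1 + p / 4 * (2 / 3))\<^sup>2"
      using sum_squares_bound[of 1 "p / 6"] p by (simp add: power2_eq_square algebra_simps)
    ultimately have "p \<le> 2 * 2 powr (p / 2)" by linarith
    then have "p * 2 powr (p / 2) \<le> 2 * 2 powr (p / 2) * 2 powr (p / 2)"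
      by (rule mult_right_mono) simp
    also have "\<dots> = 2 powr (p + 1)"
      by (simp add: powr_add mult.assoc flip: powr_add[of _ "p/2"])
    finally show "2 powr (p / 2) \<le> 2 powr (p + 1) / p"
      using p by (simp add: field_simps)
  qed simp
  finally have "(LBINT z. W z) \<le> 2 powr (p + 1) / p * L2_norm f powr p" .
  \<comment> \<open>\<open>W\<close> is Borel measurable, so passing from \<open>lborel\<close> to
    its completion changes neither integrability nor the integral.\<close>
  then show ?thesis
    using W_int W_meas unfolding W_def[symmetric]
    by (simp add: integrable_completion integral_completion)
qed

end
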